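(* Let $G$ be a uniquely $C_4^{+}$-saturated graph with $k\geq 1$ triangles, and let $A$ be the set of all vertices of $G$ that lie in some triangle of $G$. Then $N^{2}(A)=\emptyset$.
   Context: All graphs are finite, simple and undirected. $C_4^{+}$ (the diamond) is the graph obtained from a $4$-cycle by adding one chord, i.e. $K_4$ minus an edge. For a graph $H$, a graph $G$ is uniquely $H$-saturated if $G$ contains no subgraph isomorphic to $H$, but for every pair of non-adjacent vertices $u,v$ of $G$, the graph $G+uv$ contains exactly one subgraph isomorphic to $H$. A triangle is a subgraph isomorphic to $K_3$. For $U\subseteq V(G)$, $d(v,U)=\min\{d(v,u):u\in U\}$ and $N^{2}(U)=\{v\in V(G): d(v,U)=2\}$. *)

theory Defs
  imports "Graph_Theory.Graph_Theory"
begin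

text \<open>A finite simple undirected graph is a \<open>pair_graph\<close>: the finite, loop-free, symmetric digraph
  in which every edge \<open>{u, v}\<close> is represented by the two arcs \<open>(u, v)\<close> and \<open>(v, u)\<close>.\<close>

text \<open>The subgraphs of \<open>G\<close> (not necessarily induced) that are isomorphic to \<open>H\<close>. They are counted as
  subgraphs, not as embeddings. If \<open>H\<close> is symmetric, so is each of them.\<close>

definition copies :: "'b pair_pre_digraph \<Rightarrow> 'a pair_pre_digraph \<Rightarrow> 'a pair_pre_digraph set" where
  "copies H G = {S. subgraph (with_proj S) (with_proj G) \<and> digraph_iso (with_proj S) (with_proj H)}"

definition add_edge :: "'a pair_pre_digraph \<Rightarrow> 'a \<Rightarrow> 'a \<Rightarrow> 'a pair_pre_digraph" where
  "add_edge G u v = \<lparr> pverts = pverts G, parcs = parcs G \<union> {(u, v), (v, u)} \<rparr>"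

definition uniquely_saturated :: "'b pair_pre_digraph \<Rightarrow> 'a pair_pre_digraph \<Rightarrow> bool" where
  "uniquely_saturated H G \<longleftrightarrow>
     copies H G = {} \<and>
     (\<forall>u \<in> pverts G. \<forall>v \<in> pverts G. u \<noteq> v \<and> (u, v) \<notin> parcs G \<longrightarrow>
        card (copies H (add_edge G u v)) = 1)"

text \<open>The 4-cycle \<open>0, 1, 2, 3\<close> with the chord \<open>{0, 2}\<close>.\<close>

definition diamond :: "nat pair_pre_digraph" where
  "diamond = \<lparr> pverts = {0, 1, 2, 3},
     parcs = {(0, 1), (1, 2), (2, 3), (3, 0), (0, 2)} \<union> {(0, 1), (1, 2), (2, 3), (3, 0), (0, 2)}\<inverse> \<rparr>"

definition complete_graph :: "nat \<Rightarrow> nat pair_pre_digraph" where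
  "complete_graph n = \<lparr> pverts = {..<n}, parcs = {(u, v). u < n \<and> v < n \<and> u \<noteq> v} \<rparr>"

definition triangles :: "'a pair_pre_digraph \<Rightarrow> 'a pair_pre_digraph set" where
  "triangles G = copies (complete_graph 3) G"

definition triangle_verts :: "'a pair_pre_digraph \<Rightarrow> 'a set" where
  "triangle_verts G = {v \<in> pverts G. \<exists>T \<in> triangles G. v \<in> pverts T}"

text \<open>Distances are extended reals, \<open>\<infinity>\<close> between different components. For finite nonempty \<open>U\<close> the
  infimum is the minimum.\<close>

definition graph_dist :: "'a pair_pre_digraph \<Rightarrow> 'a \<Rightarrow> 'a \<Rightarrow> ereal" where
  "graph_dist G u v = wf_digraph.\<mu> (with_proj G) (\<lambda>_. 1) u v"

definition set_dist :: "'a pair_pre_digraph \<Rightarrow> 'a \<Rightarrow> 'a set \<Rightarrow> ereal" where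
  "set_dist G v U = (INF u \<in> U. graph_dist G v u)"

definition second_nbhd :: "'a pair_pre_digraph \<Rightarrow> 'a set \<Rightarrow> 'a set" where
  "second_nbhd G U = {v \<in> pverts G. set_dist G v U = 2}"

lemma graph_dist_conv:
  assumes "pair_graph G"
  shows "graph_dist G u v = (INF p \<in> {p. pre_digraph.awalk (with_proj G) u p v}. ereal (real (length p)))"
proof -
  interpret pair_graph G by fact
  have "awalk_cost (\<lambda>_. 1) p = real (length p)" for p :: "('a \<times> 'a) list"
    by (induct p) auto
  then show ?thesis
    by (simp add: graph_dist_def wf_digraph.\<mu>_def[OF wf_digraph])
qed

lemma pair_graph_diamond: "pair_graph diamond"
proof
  show "symmetric (with_proj diamond)"
    unfolding symmetric_def with_proj_simps diamond_def pair_pre_digraph.simps by (rule sym_Un_converse)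
  show "fst e \<in> pverts diamond" "snd e \<in> pverts diamond" "fst e \<noteq> snd e"
    if "e \<in> parcs diamond" for e
    using that by (auto simp: diamond_def)
qed (simp_all add: diamond_def)

lemma complete_digraph_complete_graph: "complete_digraph n (with_proj (complete_graph n))"
  unfolding complete_digraph_pair_def by (simp add: complete_graph_def)

lemma pair_graph_add_edge:
  assumes "pair_graph G" "u \<in> pverts G" "v \<in> pverts G" "u \<noteq> v"
  shows "pair_graph (add_edge G u v)"
proof -
  interpret pair_graph G by fact
  have sym: "sym (parcs G)"
    using pair_sym_arcs by (simp add: symmetric_def)
  show ?thesis
  proof
    show "symmetric (with_proj (add_edge G u v))"
      using sym by (simp add: symmetric_def add_edge_def sym_def)
    show "finite (pverts (add_edge G u v))" "finite (parcs (add_edge G u v))"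
      by (simp_all add: add_edge_def pair_finite_verts pair_finite_arcs)
    show "fst e \<in> pverts (add_edge G u v)" "snd e \<in> pverts (add_edge G u v)" "fst e \<noteq> snd e"
      if "e \<in> parcs (add_edge G u v)" for e
      using that assms arc_fst_in_verts arc_snd_in_verts pair_no_loops
      by (auto simp: add_edge_def)
  qed
qed

end

theory Submission
  imports Defs
begin

text \<open>
  In a uniquely diamond-saturated graph two non-adjacent vertices \<open>u\<close>, \<open>v\<close> have one or two common
  neighbours: either two, and none of the four edges involved lies in a triangle, or exactly one
  vertex \<open>x\<close>, and \<open>ux\<close> or \<open>vx\<close> lies in a triangle.

  Let \<open>w\<close> have distance at least two from \<open>A\<close> and let \<open>ab\<close> be an edge of a triangle. Then \<open>w\<close> has
  exactly two common neighbours with each of its non-neighbours; let \<open>i\<close>, \<open>j\<close> be those of \<open>w\<close> and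
  \<open>a\<close>. Put \<open>X = N(w) - {i, j}\<close> and let \<open>Y\<close> consist of the \<open>y \<in> N(a) - {i, j}\<close> such that \<open>ay\<close> is in no
  triangle. Each \<open>y \<in> Y\<close> has exactly two neighbours in \<open>X\<close>; each \<open>x \<in> X\<close> has at most two in \<open>Y\<close>, and
  it has none if it is adjacent to \<open>b\<close>, which does occur. Hence \<open>|Y| < |X|\<close>. On the other hand
  \<open>X\<close> injects into \<open>Y\<close>: send \<open>k\<close> to the common neighbour other than \<open>i\<close> of \<open>a\<close> and \<open>z\<close>, where \<open>z\<close> is
  the common neighbour other than \<open>w\<close> of \<open>i\<close> and \<open>k\<close>.
\<close>

section \<open>Copies as images of embeddings\<close>

text \<open>Between well-formed graphs, the copies of \<open>H\<close> in \<open>G\<close> are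
  exactly these images under embeddings \<open>f\<close>, so isomorphism records can be avoided.
  Several \<open>f\<close> may give the same copy.\<close>

definition image_graph :: "('b \<Rightarrow> 'a) \<Rightarrow> 'b pair_pre_digraph \<Rightarrow> 'a pair_pre_digraph" where
  "image_graph f H = \<lparr> pverts = f ` pverts H, parcs = map_prod f f ` parcs H \<rparr>"

lemma image_graph_in_copies:
  assumes "pair_wf_digraph H" "pair_wf_digraph G" and inj: "inj_on f (pverts H)"
    and "f ` pverts H \<subseteq> pverts G" "map_prod f f ` parcs H \<subseteq> parcs G"
  shows "image_graph f H \<in> copies H G"
proof -
  interpret H: pair_wf_digraph H by fact
  interpret G: pair_wf_digraph G by fact
  let ?S = "image_graph f H"
  have S: "pair_wf_digraph ?S"
    by unfold_locales (auto simp: image_graph_def dest: H.arc_fst_in_verts H.arc_snd_in_verts)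
  then interpret S: pair_wf_digraph ?S .
  \<comment> \<open>The isomorphism has to lead from the copy back to \<open>H\<close>, hence the
    inverse of \<open>f\<close>.\<close>
  define g where "g = the_inv_into (pverts H) f"
  have gf: "g (f x) = x" if "x \<in> pverts H" for x
    using that inj by (simp add: g_def the_inv_into_f_f)
  have ends: "x \<in> pverts H \<and> y \<in> pverts H" if "(x, y) \<in> parcs H" for x y
    using H.arc_fst_in_verts[OF that] H.arc_snd_in_verts[OF that] by simp
  have garc: "map_prod g g (map_prod f f e) = e" if "e \<in> parcs H" for e
    using that by (cases e) (auto simp: gf ends)
  define h where "h = \<lparr> iso_verts = g, iso_arcs = map_prod g g, iso_head = snd, iso_tail = fst \<rparr>"
  have "pre_digraph.digraph_isomorphism (with_proj ?S) h"
    unfolding pre_digraph.digraph_isomorphism_def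
  proof (intro conjI)
    show "wf_digraph (with_proj ?S)" ..
    show "inj_on (iso_verts h) (verts (with_proj ?S))"
      by (rule inj_onI) (auto simp: h_def image_graph_def gf)
    show "inj_on (iso_arcs h) (arcs (with_proj ?S))"
      by (rule inj_on_inverseI[where g = "map_prod f f"])
        (auto simp: h_def image_graph_def gf ends)
  qed (simp add: h_def)
  moreover have "with_proj H = app_iso h (with_proj ?S)"
    by (rule pre_digraph.equality)
      (simp_all add: h_def app_iso_def image_graph_def image_image gf garc del: map_prod_simp)
  ultimately have "digraph_iso (with_proj ?S) (with_proj H)"
    unfolding digraph_iso_def by blast
  moreover have "subgraph (with_proj ?S) (with_proj G)"
    using assms S.wf_digraph_axioms G.wf_digraph_axioms
    by (simp add: subgraph_def compatible_def image_graph_def)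
  ultimately show ?thesis by (simp add: copies_def)
qed

lemma copiesE:
  assumes "S \<in> copies H G"
  obtains f where "inj_on f (pverts H)" "S = image_graph f H"
    "f ` pverts H \<subseteq> pverts G" "map_prod f f ` parcs H \<subseteq> parcs G"
proof -
  from assms obtain h where sub: "subgraph (with_proj S) (with_proj G)"
    and iso: "pre_digraph.digraph_isomorphism (with_proj S) h" and H: "with_proj H = app_iso h (with_proj S)"
    by (auto simp: copies_def digraph_iso_def)
  let ?v = "iso_verts h"
  from sub have wf: "wf_digraph (with_proj S)" by (simp add: subgraph_def)
  have inj: "inj_on ?v (pverts S)"
    using iso by (simp add: pre_digraph.digraph_isomorphism_def)
  have vH: "pverts H = ?v ` pverts S"
    using H by (metis verts_app_iso with_proj_simps(1))
  \<comment> \<open>Tail and head are \<open>fst\<close> and \<open>snd\<close> on both sides, so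
    the vertex map determines the arc map.\<close>
  have "iso_tail h = fst" "iso_head h = snd"
    using arg_cong[OF H, of tail] arg_cong[OF H, of head] by simp_all
  then have "iso_arcs h e = map_prod ?v ?v e" if "e \<in> parcs S" for e
    using iso that by (auto simp: pre_digraph.digraph_isomorphism_def prod_eq_iff)
  then have aH: "parcs H = map_prod ?v ?v ` parcs S"
    using H by (metis (no_types, lifting) arcs_app_iso image_cong with_proj_simps(2))
  define f where "f = the_inv_into (pverts S) ?v"
  have fv: "f (?v x) = x" if "x \<in> pverts S" for x
    using that inj by (simp add: f_def the_inv_into_f_f)
  have ends: "fst e \<in> pverts S" "snd e \<in> pverts S" if "e \<in> parcs S" for e
    using wf_digraph.tail_in_verts[OF wf] wf_digraph.head_in_verts[OF wf] that by auto
  have "map_prod f f (map_prod ?v ?v e) = e" if "e \<in> parcs S" for e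
    using ends[OF that] by (cases e) (simp add: fv)
  then have S: "S = image_graph f H"
    by (intro pair_pre_digraph.equality)
      (simp_all add: image_graph_def vH aH image_image fv del: map_prod_simp)
  moreover have "pverts S \<subseteq> pverts G" "parcs S \<subseteq> parcs G"
    using sub by (auto simp: subgraph_def)
  moreover have "inj_on f (pverts H)"
    unfolding vH by (rule inj_onI) (auto simp: fv)
  ultimately show ?thesis
    using that[of f] by (simp add: image_graph_def)
qed

section \<open>Diamonds and triangles\<close>

text \<open>The arguments run around the 4-cycle and \<open>p\<close>, \<open>r\<close> are the ends
  of the chord. Exchanging \<open>p\<close> with \<open>r\<close>, or \<open>q\<close> with
  \<open>s\<close>, gives the same graph.\<close>

definition diamond_on :: "'a \<Rightarrow> 'a \<Rightarrow> 'a \<Rightarrow> 'a \<Rightarrow> 'a pair_pre_digraph" where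
  "diamond_on p q r s = image_graph ((!) [p, q, r, s]) diamond"

lemma parcs_diamond_on:
  "parcs (diamond_on p q r s) =
    {(p, q), (q, r), (r, s), (s, p), (p, r), (q, p), (r, q), (s, r), (p, s), (r, p)}"
proof -
  have "parcs diamond =
      {(0, 1), (1, 2), (2, 3), (3, 0), (0, 2), (1, 0), (2, 1), (3, 2), (0, 3), (2, 0)}"
    unfolding diamond_def pair_pre_digraph.simps by blast
  then show ?thesis by (simp add: diamond_on_def image_graph_def)
qed

lemma diamond_on_in_copies:
  assumes "pair_graph G" "distinct [p, q, r, s]"
    and "{(p, q), (q, r), (r, s), (s, p), (p, r)} \<subseteq> parcs G"
  shows "diamond_on p q r s \<in> copies diamond G"
proof -
  interpret G: pair_graph G by fact
  interpret D: pair_graph diamond by (rule pair_graph_diamond)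
  note sym = G.sym_arcs[unfolded symmetric_def, simplified]
  show ?thesis unfolding diamond_on_def
  proof (rule image_graph_in_copies)
    show "inj_on ((!) [p, q, r, s]) (pverts diamond)"
      using assms(2) by (auto simp: diamond_def inj_on_def numeral_3_eq_3 numeral_2_eq_2)
    show "(!) [p, q, r, s] ` pverts diamond \<subseteq> pverts G"
      using assms by (auto simp: diamond_def numeral_3_eq_3 numeral_2_eq_2
          dest: G.arc_fst_in_verts G.arc_snd_in_verts)
    show "map_prod ((!) [p, q, r, s]) ((!) [p, q, r, s]) ` parcs diamond \<subseteq> parcs G"
      using assms parcs_diamond_on[of p q r s] sym
      by (auto simp: diamond_on_def image_graph_def dest: symD)
  qed unfold_locales
qed

lemma copies_diamondE:
  assumes "S \<in> copies diamond G"
  obtains p q r s where "distinct [p, q, r, s]" "parcs (diamond_on p q r s) \<subseteq> parcs G"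
proof -
  from assms obtain f where f: "inj_on f (pverts diamond)" "map_prod f f ` parcs diamond \<subseteq> parcs G"
    by (rule copiesE)
  have "distinct [f 0, f 1, f 2, f 3]"
    using f(1) by (auto simp: diamond_def inj_on_def)
  moreover have "parcs (diamond_on (f 0) (f 1) (f 2) (f 3)) \<subseteq> parcs G"
    using f(2) by (auto simp: parcs_diamond_on diamond_def)
  ultimately show ?thesis by (rule that)
qed

text \<open>The saturation arguments turn on which edges lie in triangles. Without loops the three
  vertices are automatically distinct.\<close>

definition triangle_arc :: "'a pair_pre_digraph \<Rightarrow> 'a \<Rightarrow> 'a \<Rightarrow> bool" where
  "triangle_arc G u v \<longleftrightarrow> (\<exists>t. (u, v) \<in> parcs G \<and> (v, t) \<in> parcs G \<and> (t, u) \<in> parcs G)"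

lemma triangle_verts_iff:
  assumes "pair_graph G"
  shows "u \<in> triangle_verts G \<longleftrightarrow> (\<exists>v. triangle_arc G u v)"
proof
  interpret G: pair_graph G by fact
  note sym = G.sym_arcs[unfolded symmetric_def, simplified]
  {
    assume "u \<in> triangle_verts G"
    then obtain f where f: "inj_on f (pverts (complete_graph 3))"
        "map_prod f f ` parcs (complete_graph 3) \<subseteq> parcs G" "u \<in> f ` pverts (complete_graph 3)"
      by (auto simp: triangle_verts_def triangles_def image_graph_def elim!: copiesE)
    then obtain l :: nat where "l < 3" "u = f l" by (auto simp: complete_graph_def)
    moreover obtain m n :: nat where "m < 3" "n < 3" "m \<noteq> l" "n \<noteq> l" "m \<noteq> n"
    proof -
      have "l = 0 \<or> l = 1 \<or> l = 2" using \<open>l < 3\<close> by auto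
      then show ?thesis using that[of 1 2] that[of 0 2] that[of 0 1] by auto
    qed
    moreover have "(f x, f y) \<in> parcs G" if "x < 3" "y < 3" "x \<noteq> y" for x y
      using f(2) that by (force simp: complete_graph_def)
    ultimately show "\<exists>v. triangle_arc G u v"
      unfolding triangle_arc_def by metis
  next
    assume "\<exists>v. triangle_arc G u v"
    then obtain v t where arcs: "(u, v) \<in> parcs G" "(v, t) \<in> parcs G" "(t, u) \<in> parcs G"
      by (auto simp: triangle_arc_def)
    then have dist: "distinct [u, v, t]" and verts: "u \<in> pverts G" "v \<in> pverts G" "t \<in> pverts G"
      by (auto dest: G.pair_no_loops G.arc_fst_in_verts G.arc_snd_in_verts)
    have three: "{..<3} = {0, 1, 2 :: nat}" by auto
    have K: "pverts (complete_graph 3) = {0, 1, 2}"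
        "parcs (complete_graph 3) = {(0, 1), (1, 0), (0, 2), (2, 0), (1, 2), (2, 1)}"
      by (auto simp: complete_graph_def three)
    have "image_graph ((!) [u, v, t]) (complete_graph 3) \<in> triangles G"
      unfolding triangles_def
    proof (rule image_graph_in_copies)
      show "pair_wf_digraph (complete_graph 3)"
        by unfold_locales (auto simp: complete_graph_def)
      show "inj_on ((!) [u, v, t]) (pverts (complete_graph 3))"
        using dist by (auto simp: K inj_on_def)
      show "(!) [u, v, t] ` pverts (complete_graph 3) \<subseteq> pverts G"
        using verts by (auto simp: K)
      show "map_prod ((!) [u, v, t]) ((!) [u, v, t]) ` parcs (complete_graph 3) \<subseteq> parcs G"
        using arcs sym by (auto simp: K dest: symD)
    qed unfold_locales
    moreover have "u \<in> pverts (image_graph ((!) [u, v, t]) (complete_graph 3))"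
      by (auto simp: image_graph_def K)
    ultimately show "u \<in> triangle_verts G"
      using verts by (auto simp: triangle_verts_def)
  }
qed

section \<open>Common neighbours in uniquely diamond-saturated graphs\<close>

definition common_nbrs :: "'a pair_pre_digraph \<Rightarrow> 'a \<Rightarrow> 'a \<Rightarrow> 'a set" where
  "common_nbrs G u v = {x. (u, x) \<in> parcs G \<and> (v, x) \<in> parcs G}"

locale uniquely_diamond_saturated = pair_graph G for G :: "'a pair_pre_digraph" +
  assumes saturated: "uniquely_saturated diamond G"
begin

abbreviation adj :: "'a \<Rightarrow> 'a \<Rightarrow> bool" where "adj u v \<equiv> (u, v) \<in> parcs G"

lemma adj_sym: "adj u v \<Longrightarrow> adj v u"
  using sym_arcs by (simp add: symmetric_def sym_def)

lemma adj_irrefl: "\<not> adj u u"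
  using pair_no_loops[of "(u, u)"] by auto

lemma adj_verts: "adj u v \<Longrightarrow> u \<in> pverts G" "adj u v \<Longrightarrow> v \<in> pverts G"
  by (auto dest: arc_fst_in_verts arc_snd_in_verts)

lemma finite_nbrs: "finite {x. adj u x}"
  by (rule finite_subset[OF _ pair_finite_verts]) (auto intro: adj_verts)

lemma finite_common_nbrs: "finite (common_nbrs G u v)"
  by (rule finite_subset[OF _ finite_nbrs[of u]]) (auto simp: common_nbrs_def)

lemma common_nbrs_commute: "common_nbrs G u v = common_nbrs G v u"
  by (auto simp: common_nbrs_def)

lemma triangle_arc_sym: "triangle_arc G u v \<Longrightarrow> triangle_arc G v u"
  unfolding triangle_arc_def using adj_sym by blast

context
  fixes u v
  assumes uv: "u \<in> pverts G" "v \<in> pverts G" "u \<noteq> v" "\<not> adj u v"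
begin

text \<open>The uniqueness half of saturation. A contradiction will come from two diamonds of
  \<open>G + uv\<close> and an edge that only one of them has.\<close>

lemma new_diamond_unique:
  assumes "distinct [p, q, r, s]" "distinct [p', q', r', s']"
    and "{(p, q), (q, r), (r, s), (s, p), (p, r)} \<subseteq> parcs G \<union> {(u, v), (v, u)}"
    and "{(p', q'), (q', r'), (r', s'), (s', p'), (p', r')} \<subseteq> parcs G \<union> {(u, v), (v, u)}"
  shows "diamond_on p q r s = diamond_on p' q' r' s'"
proof -
  have "card (copies diamond (add_edge G u v)) = 1"
    using saturated uv by (simp add: uniquely_saturated_def)
  moreover have "pair_graph (add_edge G u v)"
    using uv by (intro pair_graph_add_edge) unfold_locales
  then have "diamond_on p q r s \<in> copies diamond (add_edge G u v)"
      "diamond_on p' q' r' s' \<in> copies diamond (add_edge G u v)"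
    using assms by (simp_all only: diamond_on_in_copies add_edge_def pair_pre_digraph.simps)
  ultimately show ?thesis by (metis card_1_singletonE singletonD)
qed

text \<open>The existence half of saturation. If \<open>uv\<close> is the chord of the new diamond,
  the other two vertices are common neighbours. If \<open>uv\<close> is a cycle edge, the chord
  joins one of \<open>u\<close>, \<open>v\<close> to a common neighbour and lies in a triangle that
  avoids \<open>uv\<close>.\<close>

lemma ex_common_nbr:
  "\<exists>x \<in> common_nbrs G u v. (\<exists>y \<in> common_nbrs G u v. y \<noteq> x) \<or> triangle_arc G u x \<or> triangle_arc G v x"
proof -
  have "card (copies diamond (add_edge G u v)) = 1"
    using saturated uv by (simp add: uniquely_saturated_def)
  then obtain S where "S \<in> copies diamond (add_edge G u v)"
    by (metis card_1_singletonE singletonI)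
  then obtain p q r s where dist: "distinct [p, q, r, s]"
    and sub: "parcs (diamond_on p q r s) \<subseteq> parcs G \<union> {(u, v), (v, u)}"
    by (rule copies_diamondE) (auto simp: add_edge_def)
  \<comment> \<open>The case of a cycle edge; the symmetries of the diamond reduce all four such
    edges to this one.\<close>
  have tri: ?thesis if "{u, v} = {p, q}" "adj p r" "adj q r" "adj r s" "adj s p" for p q r s
  proof -
    have "triangle_arc G p r" using that by (auto simp: triangle_arc_def)
    then show ?thesis using that by (auto simp: doubleton_eq_iff common_nbrs_def)
  qed
  \<comment> \<open>\<open>G\<close> itself has no diamond, so some edge of this one is missing in
    \<open>G\<close>, and only \<open>uv\<close> can be missing.\<close>
  have "\<not> {(p, q), (q, r), (r, s), (s, p), (p, r)} \<subseteq> parcs G"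
    using diamond_on_in_copies[OF pair_graph dist] saturated by (simp only: uniquely_saturated_def) blast
  then obtain x y where xy: "(x, y) \<in> {(p, q), (q, r), (r, s), (s, p), (p, r)}" "\<not> adj x y"
    by (meson subrelI)
  have D: "adj x y" if "(x, y) \<in> parcs (diamond_on p q r s)" "{u, v} \<noteq> {x, y}" for x y
    using subsetD[OF sub that(1)] that(2) by auto
  have "(x, y) \<in> parcs (diamond_on p q r s)"
    using xy(1) unfolding parcs_diamond_on by (elim insertE emptyE; simp)
  then have "{u, v} = {x, y}" using D xy(2) by blast
  then consider "{u, v} = {p, q}" | "{u, v} = {q, r}" | "{u, v} = {r, s}" | "{u, v} = {s, p}" | "{u, v} = {p, r}"
    using xy(1) by (elim insertE emptyE) simp_all
  then show ?thesis
  proof cases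
    case 1
    then show ?thesis
      using dist by (intro tri[of p q r s] D) (auto simp: parcs_diamond_on doubleton_eq_iff)
  next
    case 2
    then show ?thesis
      using dist by (intro tri[of r q p s] D) (auto simp: parcs_diamond_on doubleton_eq_iff)
  next
    case 3
    then show ?thesis
      using dist by (intro tri[of r s p q] D) (auto simp: parcs_diamond_on doubleton_eq_iff)
  next
    case 4
    then show ?thesis
      using dist by (intro tri[of p s r q] D) (auto simp: parcs_diamond_on doubleton_eq_iff)
  next
    case 5
    then have "adj p q" "adj r q" "adj p s" "adj r s"
      using dist by (intro D; auto simp: parcs_diamond_on doubleton_eq_iff)+
    then have "q \<in> common_nbrs G u v" "s \<in> common_nbrs G u v"
      using 5 by (auto simp: doubleton_eq_iff common_nbrs_def)
    then show ?thesis using dist by auto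
  qed
qed

text \<open>The triangle \<open>u\<close>, \<open>t\<close>, \<open>x\<close> together with
  \<open>v\<close> gives a new diamond with chord \<open>ux\<close>. A second common neighbour
  \<open>y\<close> would give another, with chord \<open>uv\<close>, that lacks the edge
  \<open>xt\<close>.\<close>

lemma common_nbrs_eq_singleton:
  assumes "x \<in> common_nbrs G u v" "triangle_arc G u x"
  shows "common_nbrs G u v = {x}"
proof (rule ccontr)
  assume "common_nbrs G u v \<noteq> {x}"
  with assms obtain y where y: "y \<in> common_nbrs G u v" "y \<noteq> x" by blast
  from assms obtain t where t: "adj x t" "adj t u"
    by (auto simp: triangle_arc_def)
  have x: "adj u x" "adj v x" using assms by (auto simp: common_nbrs_def)
  have ne: "distinct [u, x, v, y]" "distinct [u, t, x, v]"
    using x y t uv adj_irrefl adj_sym by (auto simp: common_nbrs_def)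
  have "diamond_on u x v y = diamond_on u t x v"
    using ne x y t adj_sym
    by (intro new_diamond_unique) (auto simp: common_nbrs_def)
  then have "(x, t) \<in> parcs (diamond_on u x v y)"
    by (simp add: parcs_diamond_on)
  then have "t = u \<or> t = v" using ne by (auto simp: parcs_diamond_on)
  then show False using ne by auto
qed

text \<open>If \<open>x\<close> were the only common neighbour, \<open>ex_common_nbr\<close> would
  put \<open>ux\<close> or \<open>vx\<close> in a triangle. A third one, \<open>z\<close>, would
  give two diamonds with chord \<open>uv\<close>, one through \<open>x\<close>, \<open>y\<close> and
  one through \<open>x\<close>, \<open>z\<close>.\<close>

lemma common_nbrs_eq_pair:
  assumes "x \<in> common_nbrs G u v" "\<not> triangle_arc G u x" "\<not> triangle_arc G v x"
  obtains y where "y \<noteq> x" "common_nbrs G u v = {x, y}"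
proof -
  from ex_common_nbr obtain y where y: "y \<in> common_nbrs G u v" "y \<noteq> x"
    using assms by metis
  have "common_nbrs G u v \<subseteq> {x, y}"
  proof
    fix z assume z: "z \<in> common_nbrs G u v"
    show "z \<in> {x, y}"
    proof (rule ccontr)
      assume "z \<notin> {x, y}"
      then have ne: "distinct [u, x, v, y]" "distinct [u, x, v, z]"
        using y z uv assms(1) adj_irrefl by (auto simp: common_nbrs_def)
      then have "diamond_on u x v y = diamond_on u x v z"
        using assms(1) y z adj_sym by (intro new_diamond_unique) (auto simp: common_nbrs_def)
      then have "(u, z) \<in> parcs (diamond_on u x v y)"
        by (simp add: parcs_diamond_on)
      then show False using ne \<open>z \<notin> {x, y}\<close> by (auto simp: parcs_diamond_on)
    qed
  qed
  then show ?thesis using that[of y] y assms(1) by blast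
qed

end

text \<open>This bounds the degrees in the double count; the injection from \<open>X\<close> to
  \<open>Y\<close> rests on ruling out three common neighbours.\<close>

lemma card_common_nbrs_le_2:
  assumes "u \<in> pverts G" "v \<in> pverts G" "u \<noteq> v" "\<not> adj u v"
  shows "card (common_nbrs G u v) \<le> 2"
proof -
  have vu: "v \<noteq> u" "\<not> adj v u" using assms adj_sym by auto
  obtain x where x: "x \<in> common_nbrs G u v" using ex_common_nbr[OF assms] by blast
  consider "triangle_arc G u x" | "triangle_arc G v x" | "\<not> triangle_arc G u x" "\<not> triangle_arc G v x"
    by blast
  then show ?thesis
  proof cases
    case 1
    then show ?thesis using common_nbrs_eq_singleton[OF assms x] by simp
  next
    case 2
    then show ?thesis
      using common_nbrs_eq_singleton[OF assms(2,1) vu, of x] x by (simp add: common_nbrs_commute)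
  next
    case 3
    then obtain y where "y \<noteq> x" "common_nbrs G u v = {x, y}"
      by (rule common_nbrs_eq_pair[OF assms x])
    then show ?thesis by simp
  qed
qed

section \<open>The double count\<close>

lemma no_vertex_far_from_triangles:
  assumes w: "w \<in> pverts G" "w \<notin> triangle_verts G"
    and nbrs: "\<And>x. adj w x \<Longrightarrow> x \<notin> triangle_verts G"
    and ab: "triangle_arc G a b"
  shows False
proof -
  let ?K = "common_nbrs G"
  have in_A: "p \<in> triangle_verts G" "q \<in> triangle_verts G" if "triangle_arc G p q" for p q
    using that triangle_arc_sym[OF that] unfolding triangle_verts_iff[OF pair_graph] by blast+
  \<comment> \<open>No edge at a neighbour of \<open>w\<close> lies in a triangle, so a common
    neighbour of two non-adjacent vertices that is adjacent to \<open>w\<close> always has exactly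
    one companion.\<close>
  have notri: "\<not> triangle_arc G p x" "\<not> triangle_arc G x p" if "adj w x" for p x
    using nbrs[OF that] in_A(2)[of p x] in_A(1)[of x p] by blast+
  have indep: "\<not> adj x y" if "adj w x" "adj w y" for x y
    using notri(1)[OF that(1), of w] that adj_sym by (auto simp: triangle_arc_def)
  have ab': "a \<in> triangle_verts G" "b \<in> triangle_verts G"
    using in_A[OF ab] .
  have adj_ab: "adj a b" using ab by (simp add: triangle_arc_def)
  have V: "a \<in> pverts G" "b \<in> pverts G" using adj_verts[OF adj_ab] .
  have wab: "w \<noteq> a" "w \<noteq> b" "\<not> adj w a" "\<not> adj w b"
    using ab' w nbrs by auto
  have pair: "\<exists>y. y \<noteq> x \<and> ?K u v = {x, y}"
    if "u \<in> pverts G" "v \<in> pverts G" "u \<noteq> v" "\<not> adj u v" "x \<in> ?K u v"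
      "\<not> triangle_arc G u x" "\<not> triangle_arc G v x" for u v x
    using common_nbrs_eq_pair[OF that] by metis
  have wpair: "\<exists>x y. x \<noteq> y \<and> ?K w z = {x, y}" if z: "z \<in> pverts G" "w \<noteq> z" "\<not> adj w z" for z
  proof -
    obtain x where "x \<in> ?K w z" using ex_common_nbr[OF w(1) z] by blast
    then show ?thesis using pair[OF w(1) z, of x] notri by (metis (no_types, lifting) common_nbrs_def mem_Collect_eq)
  qed
  obtain i j where ij: "i \<noteq> j" "?K w a = {i, j}" using wpair V(1) wab by blast
  then have "i \<in> ?K w a" "j \<in> ?K w a" by auto
  then have i: "adj w i" "adj a i" and j: "adj w j" "adj a j"
    by (auto simp: common_nbrs_def)
  \<comment> \<open>Removing \<open>i\<close> and \<open>j\<close> keeps \<open>X\<close> out of the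
    neighbourhood of \<open>a\<close> and \<open>Y\<close> out of that of \<open>w\<close>.\<close>
  define X where "X = {x. adj w x} - {i, j}"
  define Y where "Y = {y. adj a y \<and> \<not> triangle_arc G a y} - {i, j}"
  have X: "adj w x" "x \<noteq> i" "x \<noteq> j" "\<not> adj a x" "x \<in> pverts G" "x \<noteq> a" if "x \<in> X" for x
    using that ij wab adj_verts by (auto simp: X_def common_nbrs_def)
  have Y: "adj a y" "\<not> triangle_arc G a y" "\<not> adj w y" "y \<in> pverts G" "w \<noteq> y"
      "\<not> adj y i" "\<not> adj y j" if y: "y \<in> Y" for y
  proof -
    show y1: "adj a y" "\<not> triangle_arc G a y" "y \<in> pverts G"
      using y adj_verts by (auto simp: Y_def)
    show "\<not> adj w y" using y ij by (auto simp: Y_def common_nbrs_def)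
    show "w \<noteq> y" using y1 wab adj_sym by blast
    \<comment> \<open>Such an edge would close a triangle on \<open>ay\<close>.\<close>
    show "\<not> adj y i" "\<not> adj y j"
      using y1 i j adj_sym by (auto simp: triangle_arc_def)
  qed
  have fin: "finite X" "finite Y"
    unfolding X_def Y_def using finite_nbrs by simp_all

  \<comment> \<open>Neither \<open>i\<close> nor \<open>j\<close> is adjacent to \<open>y\<close>,
    so both common neighbours of \<open>w\<close> and \<open>y\<close> lie in
    \<open>X\<close>.\<close>
  have Y2: "card {x \<in> X. adj y x} = 2" if y: "y \<in> Y" for y
  proof -
    obtain p q where "p \<noteq> q" "?K w y = {p, q}" using wpair Y[OF y] by metis
    moreover have "{x \<in> X. adj y x} = ?K w y"
      using Y[OF y] by (auto simp: X_def common_nbrs_def)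
    ultimately show ?thesis by simp
  qed
  have X2: "card {y \<in> Y. adj y x} \<le> 2" if x: "x \<in> X" for x
  proof -
    have "{y \<in> Y. adj y x} \<subseteq> ?K a x"
      using adj_sym by (auto simp: common_nbrs_def Y_def)
    then have "card {y \<in> Y. adj y x} \<le> card (?K a x)"
      by (intro card_mono finite_common_nbrs)
    also have "\<dots> \<le> 2"
      using X[OF x] V by (intro card_common_nbrs_le_2) auto
    finally show ?thesis .
  qed
  \<comment> \<open>The source of strictness. If \<open>x0\<close> were \<open>i\<close> or
    \<open>j\<close>, it would form a triangle with \<open>a\<close> and \<open>b\<close>. Since
    \<open>ab\<close> lies in a triangle, \<open>b\<close> is the only common neighbour of
    \<open>a\<close> and \<open>x0\<close>, and \<open>b\<close> is not in \<open>Y\<close>.\<close>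
  obtain x0 where x0: "x0 \<in> ?K w b" using wpair V(2) wab by blast
  have "x0 \<in> X"
  proof -
    have "x0 \<noteq> i" "x0 \<noteq> j"
      using x0 i j adj_ab adj_sym notri(1)[of i a] notri(1)[of j a]
      unfolding common_nbrs_def triangle_arc_def by blast+
    then show ?thesis using x0 by (auto simp: X_def common_nbrs_def)
  qed
  have "?K a x0 = {b}"
    using X[OF \<open>x0 \<in> X\<close>] V x0 adj_ab ab adj_sym
    by (intro common_nbrs_eq_singleton) (auto simp: common_nbrs_def)
  then have "y = b" if "adj a y" "adj y x0" for y
    using that adj_sym[OF that(2)] by (auto simp: common_nbrs_def)
  then have "{y \<in> Y. adj y x0} = {}"
    using ab by (auto simp: Y_def)
  then have x0_0: "card {y \<in> Y. adj y x0} < 2" by (simp only: card.empty)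

  have "2 * card Y = (\<Sum>y\<in>Y. card {x \<in> X. adj y x})"
    using Y2 by simp
  also have "\<dots> = (\<Sum>x\<in>X. card {y \<in> Y. adj y x})"
    using sum.swap_restrict[OF fin(2,1), of "\<lambda>_ _. 1 :: nat" "\<lambda>y x. adj y x"] by simp
  also have "\<dots> < (\<Sum>x\<in>X. 2)"
    using X2 x0_0 \<open>x0 \<in> X\<close> fin by (intro sum_strict_mono_ex1) auto
  finally have less: "card Y < card X" by simp

  \<comment> \<open>The vertex \<open>z\<close> is recorded along with \<open>y\<close>, because
    injectivity recovers \<open>k\<close> from \<open>y\<close> by way of \<open>z\<close>.\<close>
  have "\<exists>y z. y \<in> Y \<and> adj y z \<and> adj z i \<and> adj z k \<and> z \<noteq> w \<and> z \<noteq> a" if k: "k \<in> X" for k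
  proof -
    note k' = X[OF k]
    have iV: "i \<in> pverts G" using i adj_verts by blast
    have "w \<in> ?K i k" using i k' adj_sym by (auto simp: common_nbrs_def)
    then obtain z where z: "z \<noteq> w" "?K i k = {w, z}"
      using pair[of i k w] iV k' indep i notri by metis
    then have "z \<in> ?K i k" by simp
    then have iz: "adj i z" "adj k z" by (auto simp: common_nbrs_def)
    have "z \<noteq> a" using iz k' adj_sym by blast
    have "\<not> adj a z"
      using notri(1)[OF i(1), of a] i iz adj_sym by (auto simp: triangle_arc_def)
    moreover have "i \<in> ?K a z" using i iz adj_sym by (auto simp: common_nbrs_def)
    ultimately obtain y where y: "y \<noteq> i" "?K a z = {i, y}"
      using pair[of a z i] V \<open>z \<noteq> a\<close> adj_verts(2)[OF iz(1)] notri i by metis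
    then have "y \<in> ?K a z" by simp
    then have ay: "adj a y" "adj z y" by (auto simp: common_nbrs_def)
    \<comment> \<open>Otherwise \<open>y\<close> would be the only common neighbour of
      \<open>a\<close> and \<open>z\<close>, but \<open>i\<close> is another.\<close>
    have "\<not> triangle_arc G a y"
      using common_nbrs_eq_singleton[of a z y] V adj_verts(2)[OF iz(1)] \<open>z \<noteq> a\<close> \<open>\<not> adj a z\<close> \<open>y \<in> ?K a z\<close> y
      by auto
    \<comment> \<open>Otherwise \<open>w\<close>, \<open>a\<close>, \<open>z\<close> would be three
      common neighbours of the non-adjacent \<open>i\<close> and \<open>j\<close>.\<close>
    moreover have "y \<noteq> j"
    proof
      assume "y = j"
      then have "{w, a, z} \<subseteq> ?K i j"
        using i j iz ay adj_sym by (auto simp: common_nbrs_def)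
      then have "card {w, a, z} \<le> card (?K i j)"
        by (intro card_mono finite_common_nbrs)
      also have "\<dots> \<le> 2"
        using iV i j ij(1) indep adj_verts by (intro card_common_nbrs_le_2) auto
      finally show False using z(1) \<open>z \<noteq> a\<close> wab(1) by auto
    qed
    ultimately have "y \<in> Y" using ay y by (auto simp: Y_def)
    then show ?thesis using ay iz adj_sym z \<open>z \<noteq> a\<close> by blast
  qed
  then obtain g h where gh: "\<And>k. k \<in> X \<Longrightarrow>
      g k \<in> Y \<and> adj (g k) (h k) \<and> adj (h k) i \<and> adj (h k) k \<and> h k \<noteq> w \<and> h k \<noteq> a"
    by metis
  \<comment> \<open>Retracing from \<open>y = g k\<close>: two values of \<open>z\<close> would join
    \<open>a\<close> as common neighbours of \<open>y\<close> and \<open>i\<close>. For a single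
    \<open>z\<close>, two values of \<open>k\<close> would join \<open>i\<close> as common
    neighbours of \<open>w\<close> and \<open>z\<close>.\<close>
  have "inj_on g X"
  proof (rule inj_onI)
    fix k l assume kl: "k \<in> X" "l \<in> X" "g k = g l"
    note k = gh[OF kl(1)] and l = gh[OF kl(2)] and y = Y[of "g k"]
    have hkl: "h k = h l"
    proof (rule ccontr)
      assume ne: "h k \<noteq> h l"
      have "{a, h k, h l} \<subseteq> ?K (g k) i"
        using k l kl y i adj_sym by (auto simp: common_nbrs_def)
      then have "card {a, h k, h l} \<le> card (?K (g k) i)"
        by (intro card_mono finite_common_nbrs)
      also have "\<dots> \<le> 2"
      proof (rule card_common_nbrs_le_2)
        show "g k \<in> pverts G" "\<not> adj (g k) i" using k y by blast+
        show "i \<in> pverts G" using adj_verts(2)[OF i(1)] .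
        show "g k \<noteq> i" using k by (simp add: Y_def)
      qed
      finally show False using ne k l by auto
    qed
    show "k = l"
    proof (rule ccontr)
      assume ne: "k \<noteq> l"
      have "{i, k, l} \<subseteq> ?K w (h k)"
        using k l hkl i X[OF kl(1)] X[OF kl(2)] by (auto simp: common_nbrs_def)
      then have "card {i, k, l} \<le> card (?K w (h k))"
        by (intro card_mono finite_common_nbrs)
      also have "\<dots> \<le> 2"
      proof (rule card_common_nbrs_le_2)
        show "w \<in> pverts G" "w \<noteq> h k" using w k by blast+
        show "h k \<in> pverts G" using k adj_verts(2)[of "g k" "h k"] by blast
        show "\<not> adj w (h k)" using indep[of "h k" i] k i by blast
      qed
      finally show False using ne X[OF kl(1)] X[OF kl(2)] by auto
    qed
  qed
  moreover have "g ` X \<subseteq> Y" using gh by blast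
  ultimately have "card X \<le> card Y" using fin card_inj_on_le by blast
  with less show False by simp
qed

end

section \<open>From distances to adjacency\<close>

lemma graph_dist_le_length:
  assumes "pair_graph G" "pre_digraph.awalk (with_proj G) u p v"
  shows "graph_dist G u v \<le> ereal (real (length p))"
  unfolding graph_dist_conv[OF assms(1)] using assms(2) by (auto intro: INF_lower)

theorem theorem3p3:
  fixes G :: "'a pair_pre_digraph" and k :: nat and A :: "'a set"
  assumes "pair_graph G"
    and "uniquely_saturated diamond G"
    and "card (triangles G) = k" and "k \<ge> 1"
    and "A = triangle_verts G"
  shows "second_nbhd G A = {}"
proof (rule ccontr)
  interpret uniquely_diamond_saturated G
    using assms by (simp add: uniquely_diamond_saturated_def uniquely_diamond_saturated_axioms_def)
  assume "second_nbhd G A \<noteq> {}"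
  then obtain w where w: "w \<in> pverts G" "set_dist G w A = 2"
    by (auto simp: second_nbhd_def)
  have far: "2 \<le> graph_dist G w x" if "x \<in> A" for x
    using w(2) that INF_lower[of x A "graph_dist G w"] by (simp add: set_dist_def)
  \<comment> \<open>The infimum over the empty set is \<infinity>, not 2.\<close>
  have "A \<noteq> {}"
    using w(2) by (auto simp: set_dist_def top_ereal_def)
  then obtain a b where ab: "triangle_arc G a b"
    using assms(5) triangle_verts_iff[OF assms(1)] by blast
  \<comment> \<open>The empty walk has length 0 and a single arc length 1, both below the distance
    2; this keeps \<open>w\<close> and then its neighbours out of \<open>A\<close>.\<close>
  have "w \<notin> A"
  proof
    assume "w \<in> A"
    moreover have "graph_dist G w w \<le> 0"
      using graph_dist_le_length[OF assms(1), of w "[]" w] w(1) by (simp add: awalk_Nil_iff zero_ereal_def)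
    ultimately show False using order_trans[OF far, of w 0] by simp
  qed
  moreover have "x \<notin> A" if "adj w x" for x
  proof
    assume "x \<in> A"
    moreover have "awalk w [(w, x)] x"
      using that by (simp add: awalk_Cons_iff awalk_Nil_iff adj_verts)
    then have "graph_dist G w x \<le> 1"
      using graph_dist_le_length[OF assms(1), of w "[(w, x)]" x] by (simp add: one_ereal_def)
    ultimately show False using order_trans[OF far, of x 1] by simp
  qed
  ultimately show False
    using no_vertex_far_from_triangles[OF w(1) _ _ ab] assms(5) by blast
qed

end
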